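(* Let $\Lambda=\langle A\rangle$ be a numerical semigroup of embedding dimension $n\ge 2$, where $A=\{a_1,\dots,a_n\}$ is its minimal system of generators. Let $x\in\Lambda$ and let $I=\Lambda\setminus B(x)$ be the corresponding irreducible ideal. If $|G_I(\Lambda)|=7$, then $x$ satisfies one of the following, for some generators $a_i,a_j,a_k,a_l,a_m,a_q\in A$: (1) $x=7a_i$; (2) $x=5a_i=3a_j$; (3) $x=3a_i+a_j$ or $x=a_i+3a_j$; (4) $x=5a_i$ and $x=a_j+a_k$; (5) $x=3a_i$ and ($x=2a_j+a_k$ or $x=a_j+2a_k$); (6) $x=a_i+a_j$ and $x=2a_k+a_l$; (7) $x=3a_i$ and $x=a_k+a_l$ and $x=a_m+a_q$; (8) $x=a_i+a_j$ and $x=a_k+a_l$ and $x=a_m+a_q$; (9) $x=a_i+a_j+a_k$.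
   Context: A numerical semigroup is a submonoid $\Lambda$ of $(\mathbb{Z}_{\ge 0},+)$ with finite complement; its embedding dimension is the cardinality of its minimal system of generators. For $x\in\Lambda$, $B(x)=\{y\in\Lambda: x-y\in\Lambda\}$. An ideal of $\Lambda$ is a nonempty subset $I\subset\Lambda$ with $I+\Lambda\subset I$; the irreducible ideals are of the form $\Lambda\setminus B(x)$, $x\in\Lambda$. The graph $G_I(\Lambda)$ is the simple graph with vertex set $\{v_i : i\in(\Lambda\setminus I)\setminus\{0\}\}$ in which distinct vertices $v_i,v_j$ are adjacent if and only if $i+j\in I$; thus for $I=\Lambda\setminus B(x)$ its vertices are indexed by $B(x)\setminus\{0\}$. $|G|$ denotes the order (number of vertices) of $G$. *)

theory Defs
  imports Main "Graph_Theory.Pair_Digraph"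
begin

definition numerical_semigroup :: "nat set \<Rightarrow> bool" where
  "numerical_semigroup \<Lambda> \<longleftrightarrow>
     0 \<in> \<Lambda> \<and> (\<forall>u\<in>\<Lambda>. \<forall>v\<in>\<Lambda>. u + v \<in> \<Lambda>) \<and> finite (UNIV - \<Lambda>)"

inductive_set submonoid_gen :: "nat set \<Rightarrow> nat set" for A where
  zero: "0 \<in> submonoid_gen A"
| add: "a \<in> A \<Longrightarrow> y \<in> submonoid_gen A \<Longrightarrow> a + y \<in> submonoid_gen A"

definition minimal_generators :: "nat set \<Rightarrow> nat set \<Rightarrow> bool" where
  "minimal_generators \<Lambda> A \<longleftrightarrow>
     submonoid_gen A = \<Lambda> \<and> (\<forall>B. B \<subset> A \<longrightarrow> submonoid_gen B \<noteq> \<Lambda>)"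

text \<open>The minimal system of generators is unique; see \<open>minimal_generators_unique\<close> below.\<close>

definition embedding_dim :: "nat set \<Rightarrow> nat" where
  "embedding_dim \<Lambda> = card (THE A. minimal_generators \<Lambda> A)"

text \<open>The difference \<open>x - y\<close> is meant in the integers, so \<open>y \<le> x\<close> has to be
  required explicitly: subtraction on \<^typ>\<open>nat\<close> truncates, and \<open>0 \<in> \<Lambda>\<close>.\<close>

definition B_set :: "nat set \<Rightarrow> nat \<Rightarrow> nat set" where
  "B_set \<Lambda> x = {y \<in> \<Lambda>. y \<le> x \<and> x - y \<in> \<Lambda>}"

text \<open>The vertex \<open>v\<^sub>i\<close> is identified with its index \<open>i\<close>. A simple graph is represented,
  as in \<^locale>\<open>pair_graph\<close>, by a symmetric loop-free set of arcs.\<close>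

definition ideal_graph :: "nat set \<Rightarrow> nat set \<Rightarrow> nat pair_pre_digraph" where
  "ideal_graph \<Lambda> I =
     \<lparr> pverts = (\<Lambda> - I) - {0},
       parcs = {(i, j). i \<in> (\<Lambda> - I) - {0} \<and> j \<in> (\<Lambda> - I) - {0} \<and> i \<noteq> j \<and> i + j \<in> I} \<rparr>"

definition graph_order :: "'a pair_pre_digraph \<Rightarrow> nat" where
  "graph_order G = card (pverts G)"

lemma pair_graph_ideal_graph:
  assumes "finite (\<Lambda> - I)"
  shows "pair_graph (ideal_graph \<Lambda> I)"
proof -
  let ?V = "(\<Lambda> - I) - {0}"
  have "parcs (ideal_graph \<Lambda> I) \<subseteq> ?V \<times> ?V"
    by (auto simp: ideal_graph_def)
  then have "finite (parcs (ideal_graph \<Lambda> I))"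
    using assms by (meson finite_Diff finite_SigmaI finite_subset)
  then show ?thesis
    using assms
    by unfold_locales (auto simp: ideal_graph_def symmetric_def add.commute intro!: symI)
qed

lemma submonoid_gen_add:
  "u \<in> submonoid_gen A \<Longrightarrow> v \<in> submonoid_gen A \<Longrightarrow> u + v \<in> submonoid_gen A"
  by (induction rule: submonoid_gen.induct) (auto simp: add.assoc intro: submonoid_gen.intros)

lemma submonoid_gen_remove_less:
  "u \<in> submonoid_gen A \<Longrightarrow> u < a \<Longrightarrow> u \<in> submonoid_gen (A - {a})"
proof (induction rule: submonoid_gen.induct)
  case zero
  show ?case by (rule submonoid_gen.zero)
next
  case (add b y)
  then have "b \<in> A - {a}" "y \<in> submonoid_gen (A - {a})" by auto
  then show ?case by (rule submonoid_gen.add)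
qed

lemma submonoid_gen_remove_redundant:
  assumes "a \<in> submonoid_gen (A - {a})"
  shows "submonoid_gen (A - {a}) = submonoid_gen A"
proof
  show "submonoid_gen (A - {a}) \<subseteq> submonoid_gen A"
  proof
    fix u assume "u \<in> submonoid_gen (A - {a})"
    then show "u \<in> submonoid_gen A"
      by (induction rule: submonoid_gen.induct) (auto intro: submonoid_gen.intros)
  qed
  show "submonoid_gen A \<subseteq> submonoid_gen (A - {a})"
  proof
    fix u assume "u \<in> submonoid_gen A"
    then show "u \<in> submonoid_gen (A - {a})"
    proof (induction rule: submonoid_gen.induct)
      case zero
      show ?case by (rule submonoid_gen.zero)
    next
      case (add b y)
      then show ?case
        using assms by (cases "b = a") (auto intro: submonoid_gen.add submonoid_gen_add)
    qed
  qed
qed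

lemma minimal_generators_eq:
  assumes "minimal_generators \<Lambda> A"
  shows "A = {a \<in> \<Lambda>. a \<noteq> 0 \<and> (\<forall>u\<in>\<Lambda>. \<forall>v\<in>\<Lambda>. a = u + v \<longrightarrow> u = 0 \<or> v = 0)}"
    (is "A = ?irr")
proof
  have L: "submonoid_gen A = \<Lambda>"
    using assms by (simp add: minimal_generators_def)
  have sub: "a \<in> \<Lambda>" if "a \<in> A" for a
    using submonoid_gen.add[OF that submonoid_gen.zero] L by simp
  have not_red: "a \<notin> submonoid_gen (A - {a})" if "a \<in> A" for a
    using assms that submonoid_gen_remove_redundant[of a A]
    unfolding minimal_generators_def by blast
  show "A \<subseteq> ?irr"
  proof
    fix a assume a: "a \<in> A"
    have nz: "a \<noteq> 0"
      using not_red[OF a] submonoid_gen.zero by metis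
    have "u = 0 \<or> v = 0" if "u \<in> \<Lambda>" "v \<in> \<Lambda>" "a = u + v" for u v
    proof (rule ccontr)
      assume "\<not> (u = 0 \<or> v = 0)"
      then have "u < a" "v < a" using that by auto
      then have "u \<in> submonoid_gen (A - {a})" "v \<in> submonoid_gen (A - {a})"
        using that L submonoid_gen_remove_less by auto
      then have "a \<in> submonoid_gen (A - {a})"
        using that submonoid_gen_add by simp
      then show False using not_red[OF a] by simp
    qed
    then show "a \<in> ?irr" using nz sub[OF a] by blast
  qed
  have "z \<in> ?irr \<longrightarrow> z \<in> A" if "z \<in> submonoid_gen A" for z
    using that
  proof (induction rule: submonoid_gen.induct)
    case zero
    show ?case by simp
  next
    case (add a y)
    show ?case
    proof
      assume irr: "a + y \<in> ?irr"
      have "a \<in> \<Lambda>" "y \<in> \<Lambda>" using add.hyps sub L by auto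
      then have "a = 0 \<or> y = 0" using irr by blast
      then show "a + y \<in> A"
      proof
        assume "a = 0"
        then have "a + y = y" by simp
        then show "a + y \<in> A" using irr add.IH by metis
      next
        assume "y = 0"
        then show "a + y \<in> A" using add.hyps(1) by simp
      qed
    qed
  qed
  then show "?irr \<subseteq> A" using L by blast
qed

lemma minimal_generators_unique:
  assumes "minimal_generators \<Lambda> A" "minimal_generators \<Lambda> B"
  shows "A = B"
  using minimal_generators_eq[OF assms(1)] minimal_generators_eq[OF assms(2)] by simp

lemma embedding_dim_eq_card:
  assumes "minimal_generators \<Lambda> A"
  shows "embedding_dim \<Lambda> = card A"
  using assms minimal_generators_unique
  unfolding embedding_dim_def by (metis the_equality)

end

theory Submission
  imports Defs
begin

text \<open>
  Besides \<open>0\<close> and \<open>x\<close>, the set \<open>B(x)\<close> has six elements, and \<open>y \<mapsto> x - y\<close> pairs them off; as six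
  is even, \<open>x/2\<close> is not among them. If \<open>x = a + b + s\<close> with distinct generators \<open>a\<close>, \<open>b\<close> and with
  \<open>s \<noteq> 0\<close> not a generator, the six elements are \<open>a, b, a + b, s, a + s, b + s\<close>; a generator
  dividing \<open>s\<close> is then \<open>a\<close> or \<open>b\<close>, and locating its double among the six gives \<open>x = 3a + b\<close> or
  \<open>x = a + 3b\<close>. In all other cases not covered by (9), a non-generator among the six is a multiple of a
  generator \<open>a\<close> with \<open>x = 3a\<close>, \<open>5a\<close> or \<open>7a\<close>, and it remains to inspect the three pairs.
  Alternatives (5) and (6) are contained in (9).
\<close>

section \<open>Sums of generators\<close>

lemma generator_in_submonoid: "a \<in> A \<Longrightarrow> a \<in> submonoid_gen A"
  using submonoid_gen.add[OF _ submonoid_gen.zero] by fastforce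

lemma multiple_in_submonoid: "a \<in> A \<Longrightarrow> k * a \<in> submonoid_gen A"
  by (induction k) (auto intro: submonoid_gen.intros)

text \<open>Addition is commutative, so any summand other than \<open>a\<close> can be moved to the
  front; if there is none, only copies of \<open>a\<close> are left.\<close>

lemma submonoid_cases_multiple:
  assumes "y \<in> submonoid_gen A"
  obtains k where "y = k * a"
  | b r where "b \<in> A" "b \<noteq> a" "r \<in> submonoid_gen A" "y = b + r"
proof -
  have "(\<exists>k. y = k * a) \<or> (\<exists>b\<in>A. b \<noteq> a \<and> (\<exists>r\<in>submonoid_gen A. y = b + r))"
    using assms
  proof (induction rule: submonoid_gen.induct)
    case zero
    show ?case by (metis mult_0)
  next
    case (add b y)
    show ?case
    proof (cases "b = a")
      case True
      from add.IH show ?thesis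
      proof
        assume "\<exists>k. y = k * a"
        then show ?thesis using True by (metis mult_Suc)
      next
        assume "\<exists>b\<in>A. b \<noteq> a \<and> (\<exists>r\<in>submonoid_gen A. y = b + r)"
        then show ?thesis
          using True add.hyps(1) by (metis add.left_commute submonoid_gen.add)
      qed
    qed (use add.hyps in blast)
  qed
  then show thesis using that by blast
qed

section \<open>The reflection y -> x - y on \<open>B_set \<Lambda> x\<close>\<close>

locale seven_vertices =
  fixes \<Lambda> A :: "nat set" and x :: nat
  assumes mingen: "minimal_generators \<Lambda> A"
    and x_in: "x \<in> \<Lambda>"
    and card_vertices: "card (B_set \<Lambda> x - {0}) = 7"
begin

text \<open>\<open>x\<close> is removed because it is the partner of \<open>0\<close> under y -> x -
  y.\<close>

definition P :: "nat set" where
  "P = B_set \<Lambda> x - {0, x}"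

lemma gen_eq: "submonoid_gen A = \<Lambda>"
  using mingen by (simp add: minimal_generators_def)

lemma zero_in: "0 \<in> \<Lambda>"
  using submonoid_gen.zero gen_eq by blast

lemma add_in: "u \<in> \<Lambda> \<Longrightarrow> v \<in> \<Lambda> \<Longrightarrow> u + v \<in> \<Lambda>"
  using submonoid_gen_add gen_eq by blast

lemma generator_in: "a \<in> A \<Longrightarrow> a \<in> \<Lambda>"
  using generator_in_submonoid gen_eq by blast

lemma generator_nonzero: "a \<in> A \<Longrightarrow> a \<noteq> 0"
  using minimal_generators_eq[OF mingen] by blast

lemma sum_not_generator: "u \<in> \<Lambda> \<Longrightarrow> v \<in> \<Lambda> \<Longrightarrow> u \<noteq> 0 \<Longrightarrow> v \<noteq> 0 \<Longrightarrow> u + v \<notin> A"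
  using minimal_generators_eq[OF mingen] by blast

lemma split_generator:
  assumes "y \<in> \<Lambda>" "y \<noteq> 0"
  obtains a r where "a \<in> A" "r \<in> \<Lambda>" "y = a + r"
proof -
  have "y \<in> submonoid_gen A" using assms gen_eq by simp
  then show thesis
    by (cases rule: submonoid_gen.cases) (use assms gen_eq that in auto)
qed

lemma P_iff: "y \<in> P \<longleftrightarrow> y \<in> \<Lambda> \<and> y \<noteq> 0 \<and> y < x \<and> x - y \<in> \<Lambda>"
  by (auto simp: P_def B_set_def)

lemma P_I: "u \<in> \<Lambda> \<Longrightarrow> v \<in> \<Lambda> \<Longrightarrow> u \<noteq> 0 \<Longrightarrow> v \<noteq> 0 \<Longrightarrow> x = u + v \<Longrightarrow> u \<in> P"
  unfolding P_iff by simp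

lemma P_complement: "y \<in> P \<Longrightarrow> x - y \<in> P"
  by (auto simp: P_iff)

lemma finite_P: "finite P"
  by (rule finite_subset[of _ "{..<x}"]) (auto simp: P_iff)

lemma card_P: "card P = 6"
proof -
  have "x \<noteq> 0"
  proof
    assume "x = 0"
    then have "B_set \<Lambda> x - {0} = {}" by (auto simp: B_set_def)
    then show False using card_vertices by (metis card.empty zero_neq_numeral)
  qed
  then have "x \<in> B_set \<Lambda> x - {0}"
    using x_in zero_in by (auto simp: B_set_def)
  moreover have "P = B_set \<Lambda> x - {0} - {x}" by (auto simp: P_def)
  ultimately show ?thesis using card_vertices by simp
qed

text \<open>Picks one representative from each pair {y, x - y} with two distinct members.\<close>

definition H :: "nat set" where
  "H = {y \<in> P. 2 * y < x}"

text \<open>The reflection carries \<open>H\<close> onto the upper half of \<open>P\<close>, so 6 =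
  \<open>2 * card H + card ?E\<close>. As 2y = x has at most one solution, parity forces
  \<open>?E\<close> to be empty and settles both claims together.\<close>

lemma H_and_halves: "card H = 3 \<and> {y \<in> P. 2 * y = x} = {}"
proof -
  let ?U = "{y \<in> P. x < 2 * y}" and ?E = "{y \<in> P. 2 * y = x}"
  have fin: "finite H" "finite ?U" "finite ?E" using finite_P by (auto simp: H_def)
  have "bij_betw (\<lambda>y. x - y) H ?U"
    by (rule bij_betw_byWitness[where f' = "\<lambda>y. x - y"])
       (auto simp: H_def P_iff)
  then have U: "card ?U = card H" by (simp add: bij_betw_same_card)
  have E: "card ?E \<le> 1" by (rule card_le_Suc0_iff_eq[THEN iffD2, folded One_nat_def]) (use fin in auto)
  have "P = (H \<union> ?U) \<union> ?E" by (auto simp: H_def)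
  moreover have "card ((H \<union> ?U) \<union> ?E) = card H + card ?U + card ?E"
    using fin by (subst card_Un_disjoint; auto simp: H_def card_Un_disjoint)+
  ultimately have "2 * card H + card ?E = 6" using U card_P by simp
  then have "card H = 3 \<and> card ?E = 0" using E by presburger
  then show ?thesis using fin by simp
qed

lemma card_H: "card H = 3"
  using H_and_halves by simp

lemma no_half: "y \<in> P \<Longrightarrow> x \<noteq> 2 * y"
  using H_and_halves by blast

lemma H_subset: "p \<in> H \<Longrightarrow> p \<in> P"
  by (simp add: H_def)

section \<open>Two distinct generators in a decomposition of x\<close>

lemma two_generators_below:
  assumes ab: "a \<in> A" "b \<in> A" "a \<noteq> b"
    and s: "s \<in> \<Lambda>" "s \<noteq> 0" "s \<notin> A" and x: "x = a + b + s"
  shows "x = 3 * a + b \<or> x = a + 3 * b"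
proof -
  have L: "a \<in> \<Lambda>" "b \<in> \<Lambda>" and nz: "a \<noteq> 0" "b \<noteq> 0"
    using ab generator_in generator_nonzero by auto
  have nA: "a + b \<notin> A" "a + s \<notin> A" "b + s \<notin> A"
    using sum_not_generator L nz s by auto
  let ?S = "{a, b, a + b, s, a + s, b + s}"
  have sub: "?S \<subseteq> P"
    unfolding insert_subset P_iff using L nz s x by (auto simp: add_in)
  \<comment> \<open>Equality would make \<open>s\<close> half of x. The next coincidences fail since
    \<open>a\<close> and \<open>b\<close> are generators while \<open>s\<close>,
    \<open>a + s\<close>, \<open>b + s\<close> are not; cancellation reduces the rest to
    these.\<close>
  have "a + b \<noteq> s" using no_half[of s] sub x by auto
  moreover have "a \<noteq> b + s" "b \<noteq> a + s" "a \<noteq> s" "b \<noteq> s"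
    using ab nA s by metis+
  ultimately have "card ?S = 6"
    using ab s nz by simp
  then have P: "P = ?S"
    using card_subset_eq[OF finite_P sub] card_P by simp
  obtain c t where c: "c \<in> A" "t \<in> \<Lambda>" "s = c + t"
    using split_generator s by blast
  have t: "t \<noteq> 0" using c s by (metis add_0_right)
  have "c \<in> P"
    by (rule P_I[of _ "a + b + t"]) (use c t x L add_in generator_in generator_nonzero in auto)
  then have "c = a \<or> c = b" using P c s nA by auto
  \<comment> \<open>Both cases at once: \<open>u\<close> is the generator split off from
    \<open>s\<close>, \<open>v\<close> the other one.\<close>
  moreover have "x = 3 * u + v"
    if uv: "u \<in> A" "v \<in> A" "u \<noteq> v" "P = {u, v, u + v, s, u + s, v + s}"
      "x = u + v + s" "s = u + t" for u v
  proof -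
    have U: "u \<in> \<Lambda>" "u \<noteq> 0" "v \<in> \<Lambda>" "v \<noteq> 0"
      using uv generator_in generator_nonzero by auto
    have "2 * u \<in> P"
      by (rule P_I[of _ "v + t"]) (use U c t uv add_in[of u u] add_in in \<open>auto simp: mult_2\<close>)
    moreover have "2 * u \<notin> A" using sum_not_generator[of u u] U by (simp add: mult_2)
    \<comment> \<open>2u is no generator, and 2u = u + v or 2u = u + s would give u = v or u =
      s.\<close>
    ultimately have "2 * u = s \<or> 2 * u = v + s"
      using uv s by auto
    \<comment> \<open>This discards 2u = v + s, which by s = u + t would become u = v + t; hence s =
      2u.\<close>
    moreover have "u \<noteq> v + t"
      using sum_not_generator[of v t] U uv c t by blast
    ultimately show ?thesis using uv by auto
  qed
  from this[of a b] this[of b a] have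
    "c = a \<Longrightarrow> x = 3 * a + b" "c = b \<Longrightarrow> x = 3 * b + a"
    using ab P x c by (auto simp: insert_commute add.commute)
  ultimately show ?thesis by auto
qed

section \<open>Multiples of a single generator\<close>

lemma multiple_in_P:
  assumes "a \<in> A" "x = k * a" "0 < i" "i < k"
  shows "i * a \<in> P"
proof (rule P_I[of _ "(k - i) * a"])
  show "i * a \<in> \<Lambda>" "(k - i) * a \<in> \<Lambda>"
    using multiple_in_submonoid assms(1) gen_eq by blast+
qed (use assms generator_nonzero in \<open>auto simp: add_mult_distrib[symmetric]\<close>)

text \<open>The elements a, 2a, ..., (k-1)a of \<open>P\<close> are distinct, so k - 1 is at most 6;
  an even k would put x/2 into \<open>P\<close>.\<close>

lemma multiple_cases:
  assumes a: "a \<in> A" "x = k * a" and "3 \<le> k"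
  shows "k = 3 \<or> k = 5 \<or> k = 7"
proof -
  have "(\<lambda>i. i * a) ` {1..<k} \<subseteq> P"
    using multiple_in_P[OF a] by auto
  moreover have "card ((\<lambda>i. i * a) ` {1..<k}) = k - 1"
    using generator_nonzero[OF a(1)] by (subst card_image) (auto simp: inj_on_def)
  ultimately have "k - 1 \<le> 6"
    using card_mono[OF finite_P] card_P by metis
  moreover have "odd k"
  proof
    assume "even k"
    then obtain m where m: "k = 2 * m" by blast
    then have "m * a \<in> P" using multiple_in_P[OF a, of m] assms(3) by auto
    then show False using no_half[of "m * a"] a(2) m by (simp add: mult.assoc)
  qed
  ultimately show ?thesis using assms(3) by presburger
qed

text \<open>Under \<open>pure\<close>, once \<open>a\<close> is split off from z, no other generator
  can occur in the rest of z or in x - z, so both are multiples of \<open>a\<close>.\<close>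

lemma nongenerator_cases:
  assumes pure: "\<And>a b s. \<lbrakk>a \<in> A; b \<in> A; s \<in> \<Lambda>; s \<noteq> 0; x = a + b + s\<rbrakk> \<Longrightarrow> a = b"
    and z: "z \<in> P" "z \<notin> A"
  obtains a where "a \<in> A" "x = 7 * a"
  | a where "a \<in> A" "x = 5 * a" "z = 2 * a \<or> z = 3 * a \<or> z = 4 * a"
  | a where "a \<in> A" "x = 3 * a" "z = 2 * a"
proof -
  obtain a y where a: "a \<in> A" "y \<in> \<Lambda>" "z = a + y"
    using split_generator z(1) by (auto simp: P_iff)
  have y: "y \<noteq> 0" using a z by (metis add_0_right)
  define w where "w = x - z"
  have w: "w \<in> \<Lambda>" "w \<noteq> 0" "x = a + y + w"
    using z a by (auto simp: w_def P_iff)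
  \<comment> \<open>Used for (y, w) and (w, y); the nonzero \<open>v\<close> makes
    \<open>r + v\<close> nonzero, as \<open>pure\<close> requires.\<close>
  have mult: "\<exists>k. u = k * a"
    if u: "u \<in> \<Lambda>" "v \<in> \<Lambda>" "v \<noteq> 0" "x = a + u + v" for u v
  proof -
    have "u \<in> submonoid_gen A" using u gen_eq by simp
    then show ?thesis
    proof (cases rule: submonoid_cases_multiple[where a = a])
      case (2 b r)
      then have "x = a + b + (r + v)" using u by simp
      then have "a = b"
        using pure[of a b "r + v"] 2 a u gen_eq add_in by auto
      then show ?thesis using 2 by simp
    qed blast
  qed
  obtain j where j: "y = j * a" using mult[of y w] a w by blast
  obtain l where l: "w = l * a" using mult[of w y] a w y by (auto simp: ac_simps)
  have pos: "0 < j" "0 < l" using j l y w by auto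
  have x: "x = (1 + j + l) * a" and zj: "z = (1 + j) * a"
    using w j l a by (auto simp: algebra_simps)
  \<comment> \<open>Positive j and l leave few positions for z = (1 + j) a; for x = 7a none is
    recorded, as (1) then holds.\<close>
  consider "1 + j + l = 3" | "1 + j + l = 5" | "1 + j + l = 7"
    using multiple_cases[OF a(1) x] pos by linarith
  then show thesis
  proof cases
    case 1
    then have "1 + j = 2" using pos by linarith
    then show thesis using that(3)[of a] a x zj 1 by metis
  next
    case 2
    then have "1 + j = 2 \<or> 1 + j = 3 \<or> 1 + j = 4" using pos by linarith
    then show thesis using that(2)[of a] a x zj 2 by metis
  next
    case 3
    then show thesis using that(1)[of a] a x by metis
  qed
qed

section \<open>Inspection of the three pairs\<close>

lemma generator_expressions_exhausted:
  assumes no1: "\<And>a. a \<in> A \<Longrightarrow> x \<noteq> 7 * a"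
    and no2: "\<And>a b. \<lbrakk>distinct [a, b]; {a, b} \<subseteq> A; x = 5 * a; x = 3 * b\<rbrakk> \<Longrightarrow> False"
    and no3: "\<And>a b. \<lbrakk>distinct [a, b]; {a, b} \<subseteq> A\<rbrakk> \<Longrightarrow> x \<noteq> 3 * a + b \<and> x \<noteq> a + 3 * b"
    and no4: "\<And>a b c. \<lbrakk>distinct [a, b, c]; {a, b, c} \<subseteq> A; x = 5 * a; x = b + c\<rbrakk> \<Longrightarrow> False"
    and no7: "\<And>a b c d e. \<lbrakk>distinct [a, b, c, d, e]; {a, b, c, d, e} \<subseteq> A;
      x = 3 * a; x = b + c; x = d + e\<rbrakk> \<Longrightarrow> False"
    and no8: "\<And>a b c d e f. \<lbrakk>distinct [a, b, c, d, e, f]; {a, b, c, d, e, f} \<subseteq> A;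
      x = a + b; x = c + d; x = e + f\<rbrakk> \<Longrightarrow> False"
    and no9: "\<And>a b c. \<lbrakk>a \<noteq> b; {a, b, c} \<subseteq> A\<rbrakk> \<Longrightarrow> x \<noteq> a + b + c"
  shows False
proof -
  \<comment> \<open>With \<open>a\<close> and \<open>b\<close> distinct, x has form (9) if
    \<open>s\<close> is a generator and form (3) otherwise.\<close>
  have pure: "a = b" if "a \<in> A" "b \<in> A" "s \<in> \<Lambda>" "s \<noteq> 0" "x = a + b + s" for a b s
  proof (rule ccontr)
    assume ne: "a \<noteq> b"
    have "s \<notin> A" using no9[of a b s] ne that by auto
    then have "x = 3 * a + b \<or> x = a + 3 * b"
      using two_generators_below that ne by blast
    then show False using no3[of a b] ne that by auto
  qed
  have nongen: "(\<exists>a\<in>A. x = 5 * a \<and> (z = 2 * a \<or> z = 3 * a \<or> z = 4 * a)) \<or>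
      (\<exists>a\<in>A. x = 3 * a \<and> z = 2 * a)"
    if "z \<in> P" "z \<notin> A" for z
    by (rule nongenerator_cases[OF pure that]) (use no1 in blast)+
  have compl: "x = p + (x - p)" "p < x - p" "p \<noteq> 0" if "p \<in> H" for p
    using that by (auto simp: H_def P_iff)
  show False
  \<comment> \<open>The split decides how many of the three pairs are multiples of one generator:
    two for 5a, one for 3a, none otherwise. The pairs left consist of generators.\<close>
  proof (cases "\<exists>a\<in>A. x = 5 * a")
    case True
    then obtain a where a: "a \<in> A" "x = 5 * a" by blast
    have a0: "a \<noteq> 0" using a generator_nonzero by blast
    have "{a, 2 * a} \<subseteq> H"
      using multiple_in_P[OF a, of 1] multiple_in_P[OF a, of 2] a a0 unfolding H_def by auto
    moreover have "\<not> H \<subseteq> {a, 2 * a}"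
      using card_mono[of "{a, 2 * a}" H] card_H card_insert_le_m1[of 2 "{2 * a}" a] by auto
    ultimately obtain p where p: "p \<in> H" "p \<noteq> a" "p \<noteq> 2 * a" by blast
    have gen: "z \<in> A" if z: "z \<in> P" "z \<noteq> 2 * a" "z \<noteq> 3 * a" "z \<noteq> 4 * a" for z
    proof (rule ccontr)
      assume "z \<notin> A"
      \<comment> \<open>b = a would give 5a = 3a, so x = 3b would be alternative (2).\<close>
      moreover have "x \<noteq> 3 * b" if "b \<in> A" for b
        using no2[of a b] that a a0 by auto
      ultimately obtain b where "b \<in> A" "x = 5 * b" "z = 2 * b \<or> z = 3 * b \<or> z = 4 * b"
        using nongen[OF z(1)] by blast
      then show False using z(2-) a(2) by simp
    qed
    \<comment> \<open>2p < 5a keeps p off 3a and 4a, and x - p is 2a, 3a or 4a only when p is 3a, 2a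
      or a.\<close>
    have "p \<in> A"
      by (rule gen[OF H_subset[OF p(1)]]) (use p compl[OF p(1)] a(2) in linarith)+
    moreover have "x - p \<in> A"
      by (rule gen[OF P_complement[OF H_subset[OF p(1)]]])
        (use p compl[OF p(1)] a(2) in linarith)+
    moreover have "distinct [a, p, x - p]"
      using p compl[OF p(1)] a(2) by simp
    ultimately show False
      using no4[OF _ _ a(2) compl(1)[OF p(1)]] a(1) by blast
  next
    case not5: False
    show False
    proof (cases "\<exists>a\<in>A. x = 3 * a")
      case True
      then obtain a where a: "a \<in> A" "x = 3 * a" by blast
      have a0: "a \<noteq> 0" using a generator_nonzero by blast
      have "a \<in> H"
        using multiple_in_P[OF a, of 1] a a0 unfolding H_def by auto
      then have "card (H - {a}) = 2" using card_H by simp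
      then obtain p q where pq: "H - {a} = {p, q}" "p \<noteq> q" by (auto simp: card_2_iff)
      then have p: "p \<in> H" "p \<noteq> a" and q: "q \<in> H" "q \<noteq> a" by auto
      \<comment> \<open>A non-generator is now 2b with x = 3b, which forces b = a.\<close>
      have gen: "z \<in> A" if "z \<in> P" "z \<noteq> 2 * a" for z
        using nongen[OF that(1)] not5 that(2) a(2) by auto
      have gens: "r \<in> A \<and> x - r \<in> A" if "r \<in> H" "r \<noteq> a" for r
      proof
        show "r \<in> A"
          by (rule gen[OF H_subset[OF that(1)]])
            (use that compl[OF that(1)] a(2) in linarith)
        show "x - r \<in> A"
          by (rule gen[OF P_complement[OF H_subset[OF that(1)]]])
            (use that compl[OF that(1)] a(2) in linarith)
      qed
      \<comment> \<open>Members of \<open>H\<close> lie below x/2 and their complements above;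
        within each half, distinctness of \<open>a\<close>, \<open>p\<close>, \<open>q\<close>
        suffices.\<close>
      have "distinct [a, p, x - p, q, x - q]"
        using p q pq(2) compl[OF p(1)] compl[OF q(1)] a(2) by simp linarith
      then show False
        using no7[OF _ _ a(2) compl(1)[OF p(1)] compl(1)[OF q(1)]] gens[OF p] gens[OF q] a(1)
        by blast
    next
      case not3: False
      have gen: "z \<in> A" if "z \<in> P" for z
        using nongen[OF that] not5 not3 by blast
      obtain p q r where H: "H = {p, q, r}" "p \<noteq> q" "p \<noteq> r" "q \<noteq> r"
        using card_H by (auto simp: card_3_iff)
      then have h: "p \<in> H" "q \<in> H" "r \<in> H" by auto
      have "distinct [p, x - p, q, x - q, r, x - r]"
        using H(2-) compl[OF h(1)] compl[OF h(2)] compl[OF h(3)] by simp linarith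
      then show False
        using no8[OF _ _ compl(1)[OF h(1)] compl(1)[OF h(2)] compl(1)[OF h(3)]]
          gen H_subset P_complement h by blast
    qed
  qed
qed

end

theorem theorem2p5:
  fixes \<Lambda> A I :: "nat set" and n x :: nat
  assumes "numerical_semigroup \<Lambda>"
    and "minimal_generators \<Lambda> A"
    and "embedding_dim \<Lambda> = n"
    and "n \<ge> 2"
    and "x \<in> \<Lambda>"
    and "I = \<Lambda> - B_set \<Lambda> x"
    and "graph_order (ideal_graph \<Lambda> I) = 7"
  shows
    "(\<exists>ai\<in>A. x = 7 * ai)
   \<or> (\<exists>ai\<in>A. \<exists>aj\<in>A. distinct [ai, aj] \<and> x = 5 * ai \<and> x = 3 * aj)
   \<or> (\<exists>ai\<in>A. \<exists>aj\<in>A. distinct [ai, aj] \<and> (x = 3 * ai + aj \<or> x = ai + 3 * aj))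
   \<or> (\<exists>ai\<in>A. \<exists>aj\<in>A. \<exists>ak\<in>A. distinct [ai, aj, ak] \<and> x = 5 * ai \<and> x = aj + ak)
   \<or> (\<exists>ai\<in>A. \<exists>aj\<in>A. \<exists>ak\<in>A. distinct [ai, aj, ak] \<and>
        x = 3 * ai \<and> (x = 2 * aj + ak \<or> x = aj + 2 * ak))
   \<or> (\<exists>ai\<in>A. \<exists>aj\<in>A. \<exists>ak\<in>A. \<exists>al\<in>A. distinct [ai, aj, ak, al] \<and>
        x = ai + aj \<and> x = 2 * ak + al)
   \<or> (\<exists>ai\<in>A. \<exists>ak\<in>A. \<exists>al\<in>A. \<exists>am\<in>A. \<exists>aq\<in>A. distinct [ai, ak, al, am, aq] \<and>
        x = 3 * ai \<and> x = ak + al \<and> x = am + aq)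
   \<or> (\<exists>ai\<in>A. \<exists>aj\<in>A. \<exists>ak\<in>A. \<exists>al\<in>A. \<exists>am\<in>A. \<exists>aq\<in>A. distinct [ai, aj, ak, al, am, aq] \<and>
        x = ai + aj \<and> x = ak + al \<and> x = am + aq)
   \<or> (\<exists>ai\<in>A. \<exists>aj\<in>A. \<exists>ak\<in>A. \<not> (ai = aj \<and> aj = ak) \<and> x = ai + aj + ak)"
proof (rule ccontr)
  assume fail: "\<not> ?thesis"
  \<comment> \<open>\<open>f1\<close>, \<open>f2\<close>, \<open>f3\<close>, \<open>f6\<close>,
    \<open>f7\<close> begin with the negations of (2), (3), (4), (7), (8).\<close>
  note f1 = fail[unfolded de_Morgan_disj, THEN conjunct2]
  note f2 = f1[THEN conjunct2]
  note f3 = f2[THEN conjunct2]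
  note f6 = f3[THEN conjunct2, THEN conjunct2, THEN conjunct2]
  note f7 = f6[THEN conjunct2]
  \<comment> \<open>\<open>B_set \<Lambda> x\<close> lies in \<Lambda>, so removing \<open>I\<close>
    from \<Lambda> gives it back.\<close>
  have "graph_order (ideal_graph \<Lambda> I) = card (B_set \<Lambda> x - {0})"
    unfolding graph_order_def ideal_graph_def assms(6)
    by (auto simp: B_set_def intro: arg_cong[of _ _ card])
  then have "card (B_set \<Lambda> x - {0}) = 7" using assms(7) by simp
  then have sv: "seven_vertices \<Lambda> A x"
    by (intro seven_vertices.intro assms(2,5))
  show False
  proof (rule seven_vertices.generator_expressions_exhausted[OF sv])
    show "x \<noteq> 7 * a" if "a \<in> A" for a
      using fail[unfolded de_Morgan_disj, THEN conjunct1] that by blast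
    show False if "distinct [a, b]" "{a, b} \<subseteq> A" "x = 5 * a" "x = 3 * b" for a b
      using f1[THEN conjunct1] that by blast
    show "x \<noteq> 3 * a + b \<and> x \<noteq> a + 3 * b" if "distinct [a, b]" "{a, b} \<subseteq> A" for a b
      using f2[THEN conjunct1] that by blast
    show False if "distinct [a, b, c]" "{a, b, c} \<subseteq> A" "x = 5 * a" "x = b + c" for a b c
      using f3[THEN conjunct1] that by blast
    show False
      if "distinct [a, b, c, d, e]" "{a, b, c, d, e} \<subseteq> A" "x = 3 * a" "x = b + c" "x = d + e"
      for a b c d e
      using f6[THEN conjunct1] that by blast
    show False
      if "distinct [a, b, c, d, e, f]" "{a, b, c, d, e, f} \<subseteq> A"
        "x = a + b" "x = c + d" "x = e + f" for a b c d e f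
      using f7[THEN conjunct1] that by blast
    show "x \<noteq> a + b + c" if "a \<noteq> b" "{a, b, c} \<subseteq> A" for a b c
      using f7[THEN conjunct2] that by blast
  qed
qed

end
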